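(* Let $k\ge0$, and let $$G^{(k)}(q,u,v,x)=\sum_{r,i,j,n\ge0}|\{\pi\in\mathcal{A}^{(k)}_n : \operatorname{inv}(\pi)=r,\ \operatorname{fp}(\pi)=i,\ \operatorname{exc}(\pi)=j\}|\; q^r u^i v^j x^n.$$ Then $G^{(k)}(q,u,v,x)$ equals the finite continued fraction $$\cfrac{1}{1-ux-\cfrac{vqx^2}{1-((1+v)q+uq^2)x-\cfrac{vq^3(1+q)^2x^2}{\ddots\; 1-((1+v)q^{k-1}[k-1]_q+uq^{2k-2})x-\cfrac{vq^{2k-1}[k]_q^2x^2}{1-((1+v)q^k[k]_q+uq^{2k})x}}}}.$$ That is, $G^{(k)}=1/C_0$, where $C_k=1-((1+v)q^k[k]_q+uq^{2k})x$ and $C_h=1-((1+v)q^h[h]_q+uq^{2h})x-\dfrac{vq^{2h+1}[h+1]_q^2x^2}{C_{h+1}}$ for $0\le h<k$.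
   Context: $\mathcal{S}_n$ is the set of permutations of $\{1,\dots,n\}$. For $k\ge0$, $$\mathcal{A}^{(k)}_n=\{\pi\in\mathcal{S}_n : |\{j : j\le i\text{ and }\pi(j)>i\}|\le k\text{ for every } i\in\{1,\dots,n\}\},$$ where for $n=0$ the set consists of the empty permutation only, contributing $1$ to the generating function. For $\pi\in\mathcal{S}_n$, $\operatorname{inv}(\pi)$ is the number of pairs $(i,j)$ with $i<j$ and $\pi(i)>\pi(j)$, $\operatorname{fp}(\pi)$ is the number of $i$ with $\pi(i)=i$, and $\operatorname{exc}(\pi)$ is the number of $i$ with $\pi(i)>i$. Notation: $[h]_q=1+q+q^2+\dots+q^{h-1}$, with $[0]_q=0$. The identity is one of formal power series in $x$ with coefficients polynomials in $q,u,v$. *)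

theory Defs
  imports
    "HOL-Combinatorics.Permutations"
    "HOL-Computational_Algebra.Formal_Power_Series"
    "HOL-Computational_Algebra.Polynomial"
    "HOL-Library.Groups_Big_Fun"
begin

definition bounded_perms :: "nat \<Rightarrow> nat \<Rightarrow> (nat \<Rightarrow> nat) set" where
  "bounded_perms k n =
     {\<pi>. \<pi> permutes {1..n} \<and>
          (\<forall>i\<in>{1..n}. card {j\<in>{1..n}. j \<le> i \<and> \<pi> j > i} \<le> k)}"

definition inv_stat :: "nat \<Rightarrow> (nat \<Rightarrow> nat) \<Rightarrow> nat" where
  "inv_stat n \<pi> = card {(i, j). i \<in> {1..n} \<and> j \<in> {1..n} \<and> i < j \<and> \<pi> i > \<pi> j}"

definition fp_stat :: "nat \<Rightarrow> (nat \<Rightarrow> nat) \<Rightarrow> nat" where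
  "fp_stat n \<pi> = card {i\<in>{1..n}. \<pi> i = i}"

definition exc_stat :: "nat \<Rightarrow> (nat \<Rightarrow> nat) \<Rightarrow> nat" where
  "exc_stat n \<pi> = card {i\<in>{1..n}. \<pi> i > i}"

text \<open>
  The coefficient ring of the power series in \<open>x\<close> is \<open>\<int>[q,u,v]\<close>, realised as
  \<open>\<int>[q][u][v]\<close>.
\<close>

type_synonym qpoly = "int poly poly poly"

definition var_q :: qpoly where "var_q = [:[:[:0, 1:]:]:]"
definition var_u :: qpoly where "var_u = [:[:0, 1:]:]"
definition var_v :: qpoly where "var_v = [:0, 1:]"

text \<open>
  \<^const>\<open>Sum_any\<close> sums over the finite set of indices where the summand does not vanish
  (finiteness is \<open>finite_support\<close> below).
\<close>

definition G_series :: "nat \<Rightarrow> qpoly fps" where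
  "G_series k = Abs_fps (\<lambda>n. Sum_any (\<lambda>(r, i, j).
     of_nat (card {\<pi> \<in> bounded_perms k n.
        inv_stat n \<pi> = r \<and> fp_stat n \<pi> = i \<and> exc_stat n \<pi> = j})
     * var_q ^ r * var_u ^ i * var_v ^ j))"

definition q_num :: "nat \<Rightarrow> qpoly" where
  "q_num h = (\<Sum>i<h. var_q ^ i)"

text \<open>
  Since \<open>\<int>[q,u,v]\<close> is not a field, \<^term>\<open>inverse\<close> is not available on the power series.
  The recursively computed \<^term>\<open>fps_right_inverse f 1\<close> is the two-sided inverse of
  every \<open>f\<close> with constant coefficient 1 (see \<open>fps_recip\<close>); all denominators of
  the continued fraction are of this form (see \<open>cf_denom_nth_0\<close>).
\<close>

definition fps_recip :: "qpoly fps \<Rightarrow> qpoly fps" where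
  "fps_recip f = fps_right_inverse f 1"

definition cf_lin :: "nat \<Rightarrow> qpoly fps" where
  "cf_lin h = 1 - fps_const ((1 + var_v) * var_q ^ h * q_num h + var_u * var_q ^ (2 * h)) * fps_X"

text \<open>The denominators \<open>C\<^sub>h\<close> of the continued fraction; only those with \<open>h \<le> k\<close> occur.\<close>

function cf_denom :: "nat \<Rightarrow> nat \<Rightarrow> qpoly fps" where
  "cf_denom k h =
     (if h < k
      then cf_lin h
           - fps_const (var_v * var_q ^ (2 * h + 1) * q_num (h + 1) ^ 2) * fps_X ^ 2
             * fps_recip (cf_denom k (h + 1))
      else cf_lin h)"
  by auto
termination by (relation "Wellfounded.measure (\<lambda>(k, h). k - h)") auto

declare cf_denom.simps [simp del]

lemma fps_recip:
  assumes "fps_nth f 0 = 1"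
  shows "f * fps_recip f = 1" "fps_recip f * f = 1"
  using fps_right_inverse[of f 1] assms by (simp_all add: fps_recip_def mult.commute)

lemma cf_denom_nth_0: "fps_nth (cf_denom k h) 0 = 1"
  by (subst cf_denom.simps) (simp add: cf_lin_def)

lemma finite_bounded_perms: "finite (bounded_perms k n)"
  by (rule finite_subset[OF _ finite_permutations[of "{1..n}"]]) (auto simp: bounded_perms_def)

lemma finite_support:
  "finite {(r, i, j). of_nat (card {\<pi> \<in> bounded_perms k n.
        inv_stat n \<pi> = r \<and> fp_stat n \<pi> = i \<and> exc_stat n \<pi> = j})
     * var_q ^ r * var_u ^ i * var_v ^ j \<noteq> 0}"
proof (rule finite_subset)
  show "finite ((\<lambda>\<pi>. (inv_stat n \<pi>, fp_stat n \<pi>, exc_stat n \<pi>)) ` bounded_perms k n)"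
    using finite_bounded_perms by blast
  have "{\<pi> \<in> bounded_perms k n.
        inv_stat n \<pi> = r \<and> fp_stat n \<pi> = i \<and> exc_stat n \<pi> = j} \<noteq> {}"
    if "of_nat (card {\<pi> \<in> bounded_perms k n.
        inv_stat n \<pi> = r \<and> fp_stat n \<pi> = i \<and> exc_stat n \<pi> = j})
     * var_q ^ r * var_u ^ i * var_v ^ j \<noteq> 0" for r i j
    using that by (auto simp del: Collect_empty_eq)
  then show "{(r, i, j). of_nat (card {\<pi> \<in> bounded_perms k n.
        inv_stat n \<pi> = r \<and> fp_stat n \<pi> = i \<and> exc_stat n \<pi> = j})
     * var_q ^ r * var_u ^ i * var_v ^ j \<noteq> 0}
     \<subseteq> (\<lambda>\<pi>. (inv_stat n \<pi>, fp_stat n \<pi>, exc_stat n \<pi>)) ` bounded_perms k n"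
    by (smt (verit, best) Collect_empty_eq case_prodE image_eqI mem_Collect_eq subsetI)
qed

lemma monomial_eq:
  "of_nat m * var_q ^ r * var_u ^ i * var_v ^ j
     = monom (monom (monom (int m) r) i) j"
proof -
  have q: "var_q ^ r = [:[:monom 1 r:]:]"
    by (induction r) (simp_all add: var_q_def monom_Suc monom_0 flip: one_pCons)
  have u: "var_u ^ i = [:monom 1 i:]"
    by (induction i) (simp_all add: var_u_def monom_Suc monom_0 flip: one_pCons)
  have v: "var_v ^ j = monom 1 j"
    by (induction j) (simp_all add: var_v_def monom_Suc monom_0 flip: one_pCons)
  show ?thesis
    by (simp add: q u v of_nat_poly smult_monom)
qed

lemma coeff_G_series:
  "coeff (coeff (coeff (fps_nth (G_series k) n) j) i) r
     = int (card {\<pi> \<in> bounded_perms k n.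
        inv_stat n \<pi> = r \<and> fp_stat n \<pi> = i \<and> exc_stat n \<pi> = j})"
proof -
  define c where "c = (\<lambda>r i j. card {\<pi> \<in> bounded_perms k n.
        inv_stat n \<pi> = r \<and> fp_stat n \<pi> = i \<and> exc_stat n \<pi> = j})"
  define M where "M = (\<lambda>(r, i, j). monom (monom (monom (int (c r i j)) r) i) j)"
  have fin: "finite {t. M t \<noteq> 0}"
    using finite_support[of k n] unfolding M_def c_def monomial_eq
    by (simp add: case_prod_unfold)
  have "fps_nth (G_series k) n = Sum_any M"
    by (simp add: G_series_def M_def c_def monomial_eq)
  also have "\<dots> = (\<Sum>t\<in>insert (r, i, j) {t. M t \<noteq> 0}. M t)"
    using fin by (intro Sum_any.expand_superset) auto
  finally have "coeff (coeff (coeff (fps_nth (G_series k) n) j) i) r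
      = (\<Sum>t\<in>insert (r, i, j) {t. M t \<noteq> 0}. coeff (coeff (coeff (M t) j) i) r)"
    by (simp only: coeff_sum)
  also have "\<dots> = (\<Sum>t\<in>insert (r, i, j) {t. M t \<noteq> 0}. if t = (r, i, j) then int (c r i j) else 0)"
    by (intro sum.cong) (auto simp: M_def coeff_monom split: if_splits)
  also have "\<dots> = int (c r i j)"
    using fin by (subst sum.delta) auto
  finally show ?thesis by (simp add: c_def)
qed

end

theory Submission
  imports Defs
begin

text \<open>
  Restrict a permutation matrix to its leading \<open>n \<times> n\<close> square: this leaves a rook placement with
  \<open>h\<close> empty rows and \<open>h\<close> empty columns, and \<open>h\<close> is the number of \<open>j \<le> n\<close> with \<open>\<pi>(j) > n\<close>.
  Passing from \<open>n\<close> to \<open>n + 1\<close> changes \<open>h\<close> by at most one. The choices of empty rows and columns to be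
  filled contribute factors \<open>[h]\<^sub>q\<close>, so the weighted count obeys the three-term recursion of
  weighted Motzkin paths of height at most \<open>k\<close>, which is solved by the continued fraction.
\<close>

section \<open>Rook placements\<close>

text \<open>Non-attacking rooks on a rectangular board: the passage from \<open>n\<close> to
  \<open>n + 1\<close> goes through an \<open>n + 1\<close> by \<open>n\<close> board.\<close>

definition placements :: "nat \<Rightarrow> nat \<Rightarrow> (nat \<times> nat) set set" where
  "placements a b = {P. P \<subseteq> {1..a} \<times> {1..b} \<and> inj_on fst P \<and> inj_on snd P}"

definition open_rows :: "nat \<Rightarrow> (nat \<times> nat) set \<Rightarrow> nat set" where
  "open_rows a P = {1..a} - fst ` P"

definition open_cols :: "nat \<Rightarrow> (nat \<times> nat) set \<Rightarrow> nat set" where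
  "open_cols b P = {1..b} - snd ` P"

lemma placementsD:
  assumes "P \<in> placements a b"
  shows "P \<subseteq> {1..a} \<times> {1..b}" "inj_on fst P" "inj_on snd P" "finite P"
  using assms finite_subset[of P "{1..a} \<times> {1..b}"] by (auto simp: placements_def)

lemma finite_placements [simp]: "finite (placements a b)"
  by (rule finite_subset[of _ "Pow ({1..a} \<times> {1..b})"]) (auto simp: placements_def)

lemma finite_open [simp]: "finite (open_rows a P)" "finite (open_cols b P)"
  by (simp_all add: open_rows_def open_cols_def)

section \<open>Counting open rows and columns\<close>

lemma card_open_rows:
  assumes "P \<in> placements a b" shows "card (open_rows a P) + card P = a"
proof -
  have s: "fst ` P \<subseteq> {1..a}" using placementsD(1)[OF assms] by auto
  have "card (open_rows a P) = a - card P"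
    using card_Diff_subset[OF finite_subset[OF s] s] placementsD(2)[OF assms]
    by (simp add: open_rows_def card_image)
  moreover have "card P \<le> a"
    using card_mono[OF _ s] placementsD(2)[OF assms] by (simp add: card_image)
  ultimately show ?thesis by simp
qed

lemma card_open_cols:
  assumes "P \<in> placements a b" shows "card (open_cols b P) + card P = b"
proof -
  have s: "snd ` P \<subseteq> {1..b}" using placementsD(1)[OF assms] by auto
  have "card (open_cols b P) = b - card P"
    using card_Diff_subset[OF finite_subset[OF s] s] placementsD(3)[OF assms]
    by (simp add: open_cols_def card_image)
  moreover have "card P \<le> b"
    using card_mono[OF _ s] placementsD(3)[OF assms] by (simp add: card_image)
  ultimately show ?thesis by simp
qed

text \<open>Each of the \<open>r - 1\<close> rows above \<open>r\<close> is either open or holds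
  exactly one rook. This converts a count of rooks into the rank of \<open>r\<close> among the open
  rows.\<close>

lemma card_open_rows_less:
  assumes P: "P \<in> placements a b" and r: "1 \<le> r" "r \<le> Suc a"
  shows "card {x\<in>P. fst x < r} + card {s\<in>open_rows a P. s < r} = r - 1"
proof -
  have inj: "inj_on fst {x\<in>P. fst x < r}"
    using placementsD(2)[OF P] by (rule inj_on_subset) auto
  have "{1..<r} = fst ` {x\<in>P. fst x < r} \<union> {s\<in>open_rows a P. s < r}"
    using placementsD(1)[OF P] r by (fastforce simp: open_rows_def)
  also have "card \<dots> = card (fst ` {x\<in>P. fst x < r}) + card {s\<in>open_rows a P. s < r}"
    by (rule card_Un_disjoint) (use placementsD(4)[OF P] in \<open>auto simp: open_rows_def\<close>)
  finally show ?thesis using card_image[OF inj] by simp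
qed

lemma card_open_cols_less:
  assumes P: "P \<in> placements a b" and c: "1 \<le> c" "c \<le> Suc b"
  shows "card {x\<in>P. snd x < c} + card {s\<in>open_cols b P. s < c} = c - 1"
proof -
  have inj: "inj_on snd {x\<in>P. snd x < c}"
    using placementsD(3)[OF P] by (rule inj_on_subset) auto
  have "{1..<c} = snd ` {x\<in>P. snd x < c} \<union> {s\<in>open_cols b P. s < c}"
    using placementsD(1)[OF P] c by (fastforce simp: open_cols_def)
  also have "card \<dots> = card (snd ` {x\<in>P. snd x < c}) + card {s\<in>open_cols b P. s < c}"
    by (rule card_Un_disjoint) (use placementsD(4)[OF P] in \<open>auto simp: open_cols_def\<close>)
  finally show ?thesis using card_image[OF inj] by simp
qed

section \<open>Enlarging the board by a row or a column\<close>

lemma insert_row_placement: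
  assumes "P \<in> placements a b" "c \<in> open_cols b P"
  shows "insert (Suc a, c) P \<in> placements (Suc a) b"
  using assms by (fastforce simp: placements_def open_cols_def inj_on_def)

text \<open>The new row is empty, or deleting its only rook leaves a placement on the old board in
  which the column of that rook is open.\<close>

lemma sum_placements_Suc_row:
  fixes f :: "(nat \<times> nat) set \<Rightarrow> 'a::comm_monoid_add"
  shows "sum f (placements (Suc a) b) =
    (\<Sum>P\<in>placements a b. f P + (\<Sum>c\<in>open_cols b P. f (insert (Suc a, c) P)))"
proof -
  define N where "N = (\<lambda>(P, c). insert (Suc a, c) P) ` (SIGMA P:placements a b. open_cols b P)"
  have dom: "Suc a \<notin> fst ` P" if "P \<in> placements a b" for P
    using placementsD(1)[OF that] by auto
  have inj: "inj_on (\<lambda>(P, c). insert (Suc a, c) P) (SIGMA P:placements a b. open_cols b P)"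
  proof (rule inj_onI, clarify)
    fix P c Q d
    assume PQ: "P \<in> placements a b" "Q \<in> placements a b"
      and eq: "insert (Suc a, c) P = insert (Suc a, d) Q"
    have n: "(Suc a, x) \<notin> P" "(Suc a, x) \<notin> Q" for x
      using dom[OF PQ(1)] dom[OF PQ(2)] by force+
    have "c = d" using eq n by blast
    then show "P = Q \<and> c = d" using eq n(1)[of c] n(2)[of c] by (metis insert_ident)
  qed
  have un: "placements (Suc a) b = placements a b \<union> N"
  proof (intro equalityI subsetI)
    fix P assume P: "P \<in> placements (Suc a) b"
    note D = placementsD[OF P]
    show "P \<in> placements a b \<union> N"
    proof (cases "Suc a \<in> fst ` P")
      case False
      have "x \<in> {1..a} \<times> {1..b}" if "x \<in> P" for x
      proof -
        have "fst x \<noteq> Suc a" using False that by force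
        then show ?thesis using D(1) that by (cases x) force
      qed
      then have "P \<in> placements a b" using D by (auto simp: placements_def)
      then show ?thesis ..
    next
      case True
      then obtain c where c: "(Suc a, c) \<in> P" by force
      define Q where "Q = P - {(Suc a, c)}"
      have Qr: "fst x \<noteq> Suc a" if "x \<in> Q" for x
        using that inj_onD[OF D(2), of x "(Suc a, c)"] c by (auto simp: Q_def)
      have "x \<in> {1..a} \<times> {1..b}" if "x \<in> Q" for x
        using D(1) that Qr[OF that] by (cases x) (force simp: Q_def)
      then have Q: "Q \<in> placements a b"
        using D by (auto simp: placements_def Q_def inj_on_diff)
      have "c \<notin> snd ` Q"
        using inj_onD[OF D(3), of _ "(Suc a, c)"] c by (auto simp: Q_def)
      then have "c \<in> open_cols b Q" using D(1) c by (auto simp: open_cols_def)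
      moreover have "P = insert (Suc a, c) Q" using c by (auto simp: Q_def)
      ultimately have "P \<in> N" using Q unfolding N_def by (intro image_eqI[of _ _ "(Q, c)"]) auto
      then show ?thesis ..
    qed
  next
    fix P assume "P \<in> placements a b \<union> N"
    then show "P \<in> placements (Suc a) b"
      by (auto simp: N_def insert_row_placement) (auto simp: placements_def)
  qed
  have "placements a b \<inter> N = {}"
    by (auto simp: N_def dest: dom)
  then have "sum f (placements (Suc a) b) = sum f (placements a b) + sum f N"
    unfolding un by (intro sum.union_disjoint) (auto simp: N_def)
  also have "sum f N = (\<Sum>(P, c)\<in>(SIGMA P:placements a b. open_cols b P). f (insert (Suc a, c) P))"
    unfolding N_def by (subst sum.reindex[OF inj]) (simp add: case_prod_unfold o_def)
  also have "\<dots> = (\<Sum>P\<in>placements a b. \<Sum>c\<in>open_cols b P. f (insert (Suc a, c) P))"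
    by (subst sum.Sigma) auto
  finally show ?thesis by (simp add: sum.distrib)
qed

lemma placements_swap: "(`) prod.swap ` placements a b = placements b a"
proof -
  have sub: "prod.swap ` P \<in> placements b a" if "P \<in> placements a b" for P and a b
    using that by (force simp: placements_def inj_on_def)
  show ?thesis
  proof (intro equalityI subsetI)
    fix P assume "P \<in> placements b a"
    then show "P \<in> (`) prod.swap ` placements a b"
      by (intro image_eqI[of _ _ "prod.swap ` P"] sub) (simp_all add: image_image)
  qed (use sub in auto)
qed

lemma sum_placements_swap:
  "sum f (placements b a) = (\<Sum>P\<in>placements a b. f (prod.swap ` P))"
proof -
  have "inj_on ((`) prod.swap) (placements a b)"
    by (simp add: inj_on_def inj_image_eq_iff)
  then show ?thesis
    unfolding placements_swap[of a b, symmetric] by (simp add: sum.reindex)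
qed

text \<open>Transposing the board reduces this to the case of a new row.\<close>

lemma sum_placements_Suc_col:
  fixes f :: "(nat \<times> nat) set \<Rightarrow> 'a::comm_monoid_add"
  shows "sum f (placements a (Suc b)) =
    (\<Sum>P\<in>placements a b. f P + (\<Sum>r\<in>open_rows a P. f (insert (r, Suc b) P)))"
proof -
  have "open_cols a (prod.swap ` P) = open_rows a P" for P
    by (simp add: open_cols_def open_rows_def image_image)
  then show ?thesis
    by (subst sum_placements_swap, subst sum_placements_Suc_row, subst sum_placements_swap)
       (simp add: image_image)
qed

section \<open>The weight of a placement\<close>

definition nw_pairs :: "(nat \<times> nat) set \<Rightarrow> nat" where
  "nw_pairs P = card {(x, y). x \<in> P \<and> y \<in> P \<and> fst x < fst y \<and> snd x < snd y}"

text \<open>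
  In a placement every open row and column will be filled later, outside the current square.
  The statistic counts the inversions among the rooks, plus those between a rook and an open row
  above it or an open column to its left; these are forced. For a rook \<open>(r, c)\<close> this number is
  \<open>(r - 1) + (c - 1)\<close> minus the number of rooks to the north-west and the number of rooks to the
  left; the latter numbers sum to \<open>card P choose 2\<close>.
\<close>

definition forced_inv :: "(nat \<times> nat) set \<Rightarrow> int" where
  "forced_inv P = (\<Sum>(r, c)\<in>P. int r - 1 + (int c - 1)) - int (nw_pairs P) - int (card P choose 2)"

definition weight :: "(nat \<times> nat) set \<Rightarrow> qpoly" where
  "weight P = var_q ^ nat (forced_inv P) * var_u ^ card {x\<in>P. fst x = snd x}
     * var_v ^ card {x\<in>P. fst x < snd x}"

text \<open>No rook lies south-east of the new one, so the new rook can only be the second member of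
  a new pair.\<close>

lemma nw_pairs_insert:
  assumes "finite P" "\<And>y. y \<in> P \<Longrightarrow> \<not> (r < fst y \<and> c < snd y)" "(r, c) \<notin> P"
  shows "nw_pairs (insert (r, c) P) = nw_pairs P + card {x\<in>P. fst x < r \<and> snd x < c}"
proof -
  let ?A = "{(x, y). x \<in> P \<and> y \<in> P \<and> fst x < fst y \<and> snd x < snd y}"
  let ?B = "{x\<in>P. fst x < r \<and> snd x < c} \<times> {(r, c)}"
  have eq: "{(x, y). x \<in> insert (r, c) P \<and> y \<in> insert (r, c) P \<and> fst x < fst y \<and> snd x < snd y} = ?A \<union> ?B"
    using assms(2) by auto
  have "finite ?A" by (rule finite_subset[of _ "P \<times> P"]) (use assms(1) in auto)
  then have "card (?A \<union> ?B) = card ?A + card ?B"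
    by (intro card_Un_disjoint) (use assms in auto)
  then show ?thesis by (simp only: nw_pairs_def eq) (simp add: card_cartesian_product_singleton card_cartesian_product)
qed

lemma forced_inv_insert:
  assumes "finite P" "\<And>y. y \<in> P \<Longrightarrow> \<not> (r < fst y \<and> c < snd y)" "(r, c) \<notin> P"
  shows "forced_inv (insert (r, c) P) = forced_inv P + (int r - 1) + (int c - 1)
     - int (card {x\<in>P. fst x < r \<and> snd x < c}) - int (card P)"
  using assms nw_pairs_insert[OF assms]
  by (simp add: forced_inv_def numeral_2_eq_2)

text \<open>The new rook is inverted with the future rook of every open row, all of which lie above
  it, and of every open column to its left. Its inversions with old rooks were counted while column
  \<open>c\<close> was open.\<close>

lemma forced_inv_insert_row:
  assumes P: "P \<in> placements a b" and c: "c \<in> open_cols b P"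
  shows "forced_inv (insert (Suc a, c) P) =
    forced_inv P + int (a - card P + card {s\<in>open_cols b P. s < c})"
proof -
  note D = placementsD[OF P]
  have cb: "1 \<le> c" "c \<le> b" and n: "(Suc a, c) \<notin> P" using c D(1) by (auto simp: open_cols_def)
  have *: "\<not> (Suc a < fst y \<and> c < snd y)" if "y \<in> P" for y using D(1) that by fastforce
  have "{x\<in>P. fst x < Suc a \<and> snd x < c} = {x\<in>P. snd x < c}" using D(1) by fastforce
  then show ?thesis
    using forced_inv_insert[OF D(4) * n] card_open_cols_less[OF P cb(1)] cb card_open_rows[OF P]
    by simp
qed

lemma forced_inv_insert_col:
  assumes P: "P \<in> placements a b" and r: "r \<in> open_rows a P"
  shows "forced_inv (insert (r, Suc b) P) =
    forced_inv P + int (b - card P + card {s\<in>open_rows a P. s < r})"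
proof -
  note D = placementsD[OF P]
  have ra: "1 \<le> r" "r \<le> a" and n: "(r, Suc b) \<notin> P" using r D(1) by (auto simp: open_rows_def)
  have *: "\<not> (r < fst y \<and> Suc b < snd y)" if "y \<in> P" for y using D(1) that by fastforce
  have "{x\<in>P. fst x < r \<and> snd x < Suc b} = {x\<in>P. fst x < r}" using D(1) by fastforce
  then show ?thesis
    using forced_inv_insert[OF D(4) * n] card_open_rows_less[OF P ra(1)] ra card_open_cols[OF P]
    by simp
qed

text \<open>Ensures that \<open>nat\<close> in \<open>weight\<close> loses nothing, so that
  increments of the statistic become powers of \<open>var_q\<close>.\<close>

lemma forced_inv_nonneg:
  assumes "P \<in> placements a b" shows "forced_inv P \<ge> 0"
proof -
  have rows: "\<forall>P\<in>placements (Suc a) b. forced_inv P \<ge> 0"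
    if IH: "\<forall>P\<in>placements a b. forced_inv P \<ge> 0" for a
  proof -
    \<comment> \<open>The recursion for sums, applied to the indicator of a negative value, acts as
      an induction principle for placements.\<close>
    have "(\<Sum>P\<in>placements (Suc a) b. of_bool (forced_inv P < 0)) = (0::nat)"
      using IH by (subst sum_placements_Suc_row) (auto simp: forced_inv_insert_row not_less)
    then show ?thesis by (subst (asm) sum_eq_0_iff) auto
  qed
  have "P \<in> placements 0 b \<Longrightarrow> forced_inv P \<ge> 0" for P
    by (simp add: placements_def forced_inv_def nw_pairs_def)
  then have "\<forall>P\<in>placements a b. forced_inv P \<ge> 0"
    by (induction a) (use rows in auto)
  with assms show ?thesis by blast
qed

text \<open>Since \<open>b \<le> a\<close>, the new rook lies strictly below the diagonal: neither a
  fixed point nor an excedance arises.\<close>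

lemma weight_insert_row:
  assumes P: "P \<in> placements a b" and "b \<le> a" and c: "c \<in> open_cols b P"
  shows "weight (insert (Suc a, c) P) =
    var_q ^ (a - card P + card {s\<in>open_cols b P. s < c}) * weight P"
proof -
  have cb: "c \<noteq> Suc a" "\<not> Suc a < c" using c \<open>b \<le> a\<close> by (auto simp: open_cols_def)
  have "{x \<in> insert (Suc a, c) P. fst x = snd x} = {x\<in>P. fst x = snd x}"
    "{x \<in> insert (Suc a, c) P. fst x < snd x} = {x\<in>P. fst x < snd x}"
    using cb by auto
  then show ?thesis
    unfolding weight_def forced_inv_insert_row[OF P c]
    using forced_inv_nonneg[OF P]
    by (simp add: nat_add_distrib power_add mult_ac)
qed

text \<open>Since \<open>a \<le> Suc b\<close>, the new rook lies above the diagonal, an excedance,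
  or in the corner \<open>(Suc b, Suc b)\<close>, a fixed point.\<close>

lemma weight_insert_col:
  assumes P: "P \<in> placements a b" and "a \<le> Suc b" and r: "r \<in> open_rows a P"
  shows "weight (insert (r, Suc b) P) =
    var_q ^ (b - card P + card {s\<in>open_rows a P. s < r}) * (if r = Suc b then var_u else var_v) * weight P"
proof -
  note D = placementsD[OF P]
  have n: "(r, Suc b) \<notin> P" using D(1) by auto
  have rb: "r = Suc b \<or> r < Suc b" using r \<open>a \<le> Suc b\<close> by (auto simp: open_rows_def)
  have "{x \<in> insert (r, Suc b) P. fst x = snd x} =
      (if r = Suc b then insert (r, Suc b) {x\<in>P. fst x = snd x} else {x\<in>P. fst x = snd x})"
    "{x \<in> insert (r, Suc b) P. fst x < snd x} =
      (if r = Suc b then {x\<in>P. fst x < snd x} else insert (r, Suc b) {x\<in>P. fst x < snd x})"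
    using rb by auto
  then show ?thesis
    unfolding weight_def forced_inv_insert_col[OF P r]
    using forced_inv_nonneg[OF P] n D(4)
    by (cases "r = Suc b") (simp_all add: nat_add_distrib power_add mult_ac)
qed

text \<open>The ranks of the elements of \<open>A\<close> are \<open>0, ..., card A - 1\<close>,
  each attained once.\<close>

lemma sum_power_rank:
  fixes A :: "nat set"
  assumes "finite A"
  shows "(\<Sum>c\<in>A. var_q ^ card {s\<in>A. s < c}) = q_num (card A)"
  using assms
proof (induction A rule: finite_linorder_max_induct)
  case empty
  then show ?case by (simp add: q_num_def)
next
  case (insert m A)
  have "{s \<in> insert m A. s < m} = A" using insert by auto
  moreover have "{s \<in> insert m A. s < c} = {s\<in>A. s < c}" if "c \<in> A" for c
    using insert that by force
  moreover have "m \<notin> A" using insert by auto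
  ultimately show ?case using insert by (simp add: q_num_def)
qed

section \<open>The transfer recursion\<close>

text \<open>Exactly one new rook at height \<open>h\<close>: the terms with \<open>1\<close>,
  \<open>var_v\<close> and \<open>var_u\<close> stand for a rook in the new row, in the new column
  above the diagonal, and in the corner.\<close>

definition level_wt :: "nat \<Rightarrow> qpoly" where
  "level_wt h = (1 + var_v) * var_q ^ h * q_num h + var_u * var_q ^ (2 * h)"

definition down_wt :: "nat \<Rightarrow> qpoly" where
  "down_wt h = var_v * var_q ^ (2 * h - 1) * q_num h ^ 2"

text \<open>Bounds by \<open>k\<close> the number of open rows of every leading square; the additive
  form avoids truncated subtraction.\<close>

definition bounded_defect :: "nat \<Rightarrow> nat \<Rightarrow> (nat \<times> nat) set \<Rightarrow> bool" where
  "bounded_defect k n P \<longleftrightarrow> (\<forall>i\<le>n. i \<le> card (P \<inter> {1..i} \<times> {1..i}) + k)"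

text \<open>With an arbitrary test function \<open>F\<close> of the final height, one enlargement of
  the board becomes an operator acting on \<open>F\<close>.\<close>

definition height_sum :: "nat \<Rightarrow> nat \<Rightarrow> (nat \<Rightarrow> qpoly) \<Rightarrow> qpoly" where
  "height_sum k n F =
    (\<Sum>P\<in>placements n n. if bounded_defect k n P then F (n - card P) * weight P else 0)"

lemma bounded_defect_Suc:
  assumes "P \<subseteq> {1..Suc n} \<times> {1..Suc n}" "Q \<subseteq> {1..n} \<times> {1..n}" "P \<inter> {1..n} \<times> {1..n} = Q"
  shows "bounded_defect k (Suc n) P \<longleftrightarrow> bounded_defect k n Q \<and> Suc n - card P \<le> k"
proof -
  have "P \<inter> {1..i} \<times> {1..i} = Q \<inter> {1..i} \<times> {1..i}" if "i \<le> n" for i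
    using assms(3) that by fastforce
  moreover have "P \<inter> {1..Suc n} \<times> {1..Suc n} = P" using assms(1) by blast
  ultimately show ?thesis unfolding bounded_defect_def by (auto simp: le_Suc_eq)
qed

lemma sum_weight_rows:
  assumes P: "P \<in> placements n n"
  defines "h \<equiv> n - card P"
  shows "(\<Sum>c\<in>open_cols n P. weight (insert (Suc n, c) P)) = var_q ^ h * q_num h * weight P"
proof -
  have "h = card (open_cols n P)" using card_open_cols[OF P] by (simp add: h_def)
  then show ?thesis
    by (simp add: weight_insert_row[OF P] power_add sum_power_rank flip: h_def sum_distrib_left sum_distrib_right)
qed

text \<open>The new row is itself open. Its corner cell has rank \<open>h\<close> below the
  \<open>h\<close> old open rows, whence the exponent \<open>2 * h\<close>.\<close>

lemma sum_weight_cols_unfilled: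
  assumes P: "P \<in> placements n n"
  defines "h \<equiv> n - card P"
  shows "(\<Sum>r\<in>open_rows (Suc n) P. weight (insert (r, Suc n) P)) =
    (var_v * var_q ^ h * q_num h + var_u * var_q ^ (2 * h)) * weight P"
proof -
  note D = placementsD[OF P]
  have h: "h = card (open_rows n P)" using card_open_rows[OF P] by (simp add: h_def)
  have P': "P \<in> placements (Suc n) n" using P by (auto simp: placements_def)
  have O: "open_rows (Suc n) P = insert (Suc n) (open_rows n P)" and n: "Suc n \<notin> open_rows n P"
    using D(1) by (auto simp: open_rows_def)
  have *: "{s \<in> open_rows (Suc n) P. s < r} = {s \<in> open_rows n P. s < r}" if "r \<le> Suc n" for r
    using that by (auto simp: O)
  have r: "{s \<in> open_rows n P. s < Suc n} = open_rows n P" by (auto simp: open_rows_def)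
  have w: "weight (insert (r, Suc n) P) = var_q ^ h * var_q ^ card {s\<in>open_rows n P. s < r} * var_v * weight P"
    if "r \<in> open_rows n P" for r
  proof -
    have "r \<in> open_rows (Suc n) P" "r \<le> Suc n" "r \<noteq> Suc n"
      using that n by (auto simp: O open_rows_def)
    then show ?thesis using weight_insert_col[OF P', of r] by (simp add: * h_def power_add)
  qed
  have w': "weight (insert (Suc n, Suc n) P) = var_q ^ (2 * h) * var_u * weight P"
    using weight_insert_col[OF P', of "Suc n"] *[of "Suc n"] O
    by (simp add: r mult_2 flip: h h_def)
  show ?thesis using n
    by (simp add: O w w' sum_power_rank h[symmetric] algebra_simps flip: sum_distrib_left sum_distrib_right)
qed

text \<open>The rook in the new row uses up one open column but no old open row, so the exponent is
  \<open>h - 1\<close> while \<open>q_num\<close> keeps \<open>h\<close>.\<close>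

lemma sum_weight_cols_filled:
  assumes P: "P \<in> placements n n" and c: "c \<in> open_cols n P"
  defines "h \<equiv> n - card P"
  shows "(\<Sum>r\<in>open_rows (Suc n) (insert (Suc n, c) P). weight (insert (r, Suc n) (insert (Suc n, c) P))) =
    var_v * var_q ^ (h - 1) * q_num h * weight (insert (Suc n, c) P)"
proof -
  note D = placementsD[OF P]
  let ?Q = "insert (Suc n, c) P"
  have Q: "?Q \<in> placements (Suc n) n" by (rule insert_row_placement[OF P c])
  have O: "open_rows (Suc n) ?Q = open_rows n P" by (auto simp: open_rows_def)
  have h: "h = card (open_rows n P)" using card_open_rows[OF P] by (simp add: h_def)
  have "(Suc n, c) \<notin> P" using D(1) by auto
  then have "card ?Q = Suc (card P)" using D(4) by simp
  then have "n - card ?Q = h - 1" by (simp add: h_def)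
  have "weight (insert (r, Suc n) ?Q)
      = var_q ^ (h - 1) * var_q ^ card {s\<in>open_rows n P. s < r} * var_v * weight ?Q"
    if "r \<in> open_rows n P" for r
  proof -
    have "r \<in> open_rows (Suc n) ?Q" "r \<noteq> Suc n"
      using that by (auto simp: O open_rows_def)
    then show ?thesis
      using weight_insert_col[OF Q, of r] \<open>n - card ?Q = h - 1\<close> by (simp add: O power_add)
  qed
  then show ?thesis
    by (simp add: O sum_power_rank h[symmetric] algebra_simps flip: sum_distrib_left sum_distrib_right)
qed

text \<open>Row and column are added in turn: no new rook raises the height by one, a single one
  keeps it, two lower it by one. The cut-off \<open>F'\<close> is the defect condition at size
  \<open>Suc n\<close>.\<close>

lemma height_sum_Suc:
  "height_sum k (Suc n) F = height_sum k n (\<lambda>h.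
     let F' = (\<lambda>h. if h \<le> k then F h else 0)
     in F' (Suc h) + level_wt h * F' h + down_wt h * F' (h - 1))"
proof -
  define F' where "F' = (\<lambda>h. if h \<le> k then F h else 0)"
  define f where "f = (\<lambda>P. if bounded_defect k (Suc n) P then F (Suc n - card P) * weight P else 0)"
  have "f P + (\<Sum>r\<in>open_rows (Suc n) P. f (insert (r, Suc n) P)) +
      (\<Sum>c\<in>open_cols n P. f (insert (Suc n, c) P)
         + (\<Sum>r\<in>open_rows (Suc n) (insert (Suc n, c) P). f (insert (r, Suc n) (insert (Suc n, c) P))))
    = (if bounded_defect k n P then
         (F' (Suc (n - card P)) + level_wt (n - card P) * F' (n - card P)
           + down_wt (n - card P) * F' (n - card P - 1)) * weight P else 0)"
    (is "?l = ?r") if P: "P \<in> placements n n" for P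
  proof -
    note D = placementsD[OF P]
    define h where "h = n - card P"
    have ch: "card P + h = n" using card_open_rows[OF P] by (simp add: h_def)
    \<comment> \<open>All enlargements restrict to \<open>P\<close>, so they share its defect
      condition; the only new condition is absorbed into \<open>F'\<close>.\<close>
    have ext: "f Q = (if bounded_defect k n P then F' (Suc n - card Q) * weight Q else 0)"
      if "Q \<subseteq> {1..Suc n} \<times> {1..Suc n}" "Q \<inter> {1..n} \<times> {1..n} = P" for Q
      using bounded_defect_Suc[OF that(1) D(1) that(2)] by (auto simp: f_def F'_def)
    have f0: "f P = (if bounded_defect k n P then F' (Suc h) * weight P else 0)"
      using D(1) ch by (subst ext) (fastforce simp flip: ch)+
    have fr: "f (insert (r, Suc n) P) = (if bounded_defect k n P then F' h * weight (insert (r, Suc n) P) else 0)"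
      if "r \<in> open_rows (Suc n) P" for r
    proof -
      have "(r, Suc n) \<notin> P" using D(1) by auto
      then have "Suc n - card (insert (r, Suc n) P) = h" using D(4) by (simp flip: ch)
      with that show ?thesis using D(1) by (subst ext) (auto simp: open_rows_def)
    qed
    have fc: "f (insert (Suc n, c) P) = (if bounded_defect k n P then F' h * weight (insert (Suc n, c) P) else 0)"
      if "c \<in> open_cols n P" for c
    proof -
      have "(Suc n, c) \<notin> P" using D(1) by auto
      then have "Suc n - card (insert (Suc n, c) P) = h" using D(4) by (simp flip: ch)
      with that show ?thesis using D(1) by (subst ext) (auto simp: open_cols_def)
    qed
    have frc: "f (insert (r, Suc n) (insert (Suc n, c) P)) =
        (if bounded_defect k n P then F' (h - 1) * weight (insert (r, Suc n) (insert (Suc n, c) P)) else 0)"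
      if "c \<in> open_cols n P" "r \<in> open_rows (Suc n) (insert (Suc n, c) P)" for c r
    proof -
      have "(Suc n, c) \<notin> P" "(r, Suc n) \<notin> P" "r \<noteq> Suc n" using D(1) that by (auto simp: open_rows_def)
      then have "Suc n - card (insert (r, Suc n) (insert (Suc n, c) P)) = h - 1" using D(4) by (simp flip: ch)
      with that show ?thesis using D(1) by (subst ext) (auto simp: open_cols_def open_rows_def)
    qed
    show ?thesis
    proof (cases "bounded_defect k n P")
      case True
      have "?l = F' (Suc h) * weight P + F' h * (\<Sum>r\<in>open_rows (Suc n) P. weight (insert (r, Suc n) P))
        + (F' h + F' (h - 1) * (var_v * var_q ^ (h - 1) * q_num h)) * (\<Sum>c\<in>open_cols n P. weight (insert (Suc n, c) P))"
        using True
        by (simp add: f0 fr fc frc sum_weight_cols_filled[OF P] sum.distrib algebra_simps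
            flip: h_def sum_distrib_left sum_distrib_right)
      also have "\<dots> = (F' (Suc h) + level_wt h * F' h
          + (var_v * (var_q ^ (h - 1) * var_q ^ h) * q_num h ^ 2) * F' (h - 1)) * weight P"
        unfolding sum_weight_rows[OF P] sum_weight_cols_unfilled[OF P] h_def[symmetric]
        by (simp add: level_wt_def algebra_simps power2_eq_square)
      \<comment> \<open>For \<open>h = 0\<close> both sides vanish because
        \<open>q_num 0 = 0\<close>; otherwise the exponents add up to
        \<open>2 * h - 1\<close>.\<close>
      also have "var_v * (var_q ^ (h - 1) * var_q ^ h) * q_num h ^ 2 = down_wt h"
        by (cases h) (simp_all add: down_wt_def q_num_def mult_2 flip: power_add)
      finally show ?thesis using True by (simp add: h_def)
    qed (simp add: f0 fr fc frc)
  qed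
  then show ?thesis
    unfolding Let_def F'_def[symmetric] height_sum_def f_def[symmetric]
      sum_placements_Suc_col sum_placements_Suc_row
    by simp
qed

text \<open>By the recursion below, the total weight of Motzkin paths with \<open>n\<close> steps
  from height 0 to \<open>h\<close> that never exceed \<open>k\<close>, up steps having weight
  1.\<close>

definition path_wt :: "nat \<Rightarrow> nat \<Rightarrow> nat \<Rightarrow> qpoly" where
  "path_wt k n h = height_sum k n (\<lambda>d. if d = h then 1 else 0)"

lemma path_wt_0: "path_wt k 0 h = (if h = 0 then 1 else 0)"
proof -
  have "placements 0 0 = {{}}" by (auto simp: placements_def)
  then show ?thesis
    by (simp add: path_wt_def height_sum_def bounded_defect_def
        weight_def forced_inv_def nw_pairs_def)
qed

lemma path_wt_gt: "k < h \<Longrightarrow> path_wt k n h = 0"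
  unfolding path_wt_def height_sum_def bounded_defect_def
proof (intro sum.neutral ballI)
  fix P assume "k < h" "P \<in> placements n n"
  moreover from this have "P \<inter> {1..n} \<times> {1..n} = P" using placementsD(1) by blast
  ultimately show "(if \<forall>i\<le>n. i \<le> card (P \<inter> {1..i} \<times> {1..i}) + k
      then (if n - card P = h then 1 else 0) * weight P else 0) = 0"
    by (auto dest: spec[of _ n])
qed

lemma height_sum_add: "height_sum k n (\<lambda>h. F h + G h) = height_sum k n F + height_sum k n G"
  unfolding height_sum_def sum.distrib[symmetric] by (intro sum.cong) (auto simp: algebra_simps)

lemma height_sum_mult: "height_sum k n (\<lambda>h. a * F h) = a * height_sum k n F"
  unfolding height_sum_def sum_distrib_left by (intro sum.cong) (auto simp: algebra_simps)

text \<open>The last step starts at height \<open>h - 1\<close>, \<open>h\<close> or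
  \<open>Suc h\<close>: the operator of \<open>height_sum_Suc\<close> is applied to the indicator of
  \<open>h\<close> and expanded into indicators.\<close>

lemma path_wt_Suc:
  assumes "h \<le> k"
  shows "path_wt k (Suc n) h = (if h = 0 then 0 else path_wt k n (h - 1))
    + level_wt h * path_wt k n h + down_wt (Suc h) * path_wt k n (Suc h)"
proof -
  let ?\<delta> = "\<lambda>h d. if d = h then 1 else 0 :: qpoly"
  \<comment> \<open>For \<open>h = 0\<close> the truncated \<open>d - 1\<close> would also let
    \<open>d = 0\<close> contribute a down step; its weight is zero.\<close>
  have "down_wt 0 = 0" by (simp add: down_wt_def q_num_def)
  then have "path_wt k (Suc n) h = height_sum k n (\<lambda>d.
      ((if h = 0 then 0 else 1) * ?\<delta> (h - 1) d + level_wt h * ?\<delta> h d) + down_wt (Suc h) * ?\<delta> (Suc h) d)"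
    unfolding path_wt_def height_sum_Suc Let_def
    using assms by (intro arg_cong[of _ _ "height_sum k n"] ext) (auto simp: not_le split: nat_diff_split)
  then show ?thesis
    unfolding height_sum_add height_sum_mult by (simp add: path_wt_def)
qed

section \<open>The continued fraction\<close>

definition path_series :: "nat \<Rightarrow> nat \<Rightarrow> qpoly fps" where
  "path_series k h = Abs_fps (\<lambda>n. path_wt k n h)"

lemma path_series_rec:
  assumes "h \<le> k"
  shows "path_series k h = (if h = 0 then 1 else fps_X * path_series k (h - 1))
    + fps_const (level_wt h) * fps_X * path_series k h
    + fps_const (down_wt (Suc h)) * fps_X * path_series k (Suc h)"
proof (rule fps_ext)
  fix n
  show "fps_nth (path_series k h) n = fps_nth ((if h = 0 then 1 else fps_X * path_series k (h - 1))
    + fps_const (level_wt h) * fps_X * path_series k h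
    + fps_const (down_wt (Suc h)) * fps_X * path_series k (Suc h)) n"
    by (cases n) (simp_all add: path_series_def path_wt_0 path_wt_Suc[OF assms] mult.assoc)
qed

lemma cf_lin_level_wt: "cf_lin h = 1 - fps_const (level_wt h) * fps_X"
  by (simp add: cf_lin_def level_wt_def)

text \<open>Descending induction from \<open>h = k\<close>: the ratio of consecutive path series is
  \<open>fps_X\<close> divided by the denominator, and at \<open>h = 0\<close> the path series is
  the reciprocal of the whole denominator.\<close>

lemma cf_denom_path_series:
  assumes "h \<le> k"
  shows "cf_denom k h * path_series k h = (if h = 0 then 1 else fps_X * path_series k (h - 1))"
  using assms
proof (induction h rule: inc_induct)
  case base
  \<comment> \<open>Height \<open>Suc k\<close> is never reached, so the recursion closes and the
    fraction is finite.\<close>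
  have "path_series k (Suc k) = 0"
    by (simp add: path_series_def path_wt_gt fps_eq_iff)
  then show ?case
    using path_series_rec[of k k]
    by (simp add: cf_denom.simps[of k k] cf_lin_level_wt algebra_simps)
next
  case (step h)
  let ?R = "fps_recip (cf_denom k (Suc h))"
  have "path_series k (Suc h) = ?R * (cf_denom k (Suc h) * path_series k (Suc h))"
    using fps_recip(2)[OF cf_denom_nth_0[of k "Suc h"]] by (simp flip: mult.assoc)
  also have "\<dots> = fps_X * ?R * path_series k h" using step.IH by (simp add: mult_ac)
  \<comment> \<open>This turns the tail of the fraction at level \<open>h\<close> into the down-step
    term of \<open>path_series_rec\<close>.\<close>
  finally have S: "fps_X * ?R * path_series k h = path_series k (Suc h)" ..
  have rearrange: "x - a - b = r" if "x = r + a + b" for x r a b :: "qpoly fps"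
    using that by simp
  have "cf_denom k h * path_series k h = path_series k h - fps_const (level_wt h) * fps_X * path_series k h
      - fps_const (down_wt (Suc h)) * fps_X * (fps_X * ?R * path_series k h)"
    using step.hyps
    by (subst cf_denom.simps) (simp add: cf_lin_level_wt down_wt_def left_diff_distrib right_diff_distrib power2_eq_square mult_ac)
  then show ?case
    unfolding S rearrange[OF path_series_rec[OF less_imp_le[OF step.hyps(2)]]] .
qed

section \<open>Permutations as full placements\<close>

definition graph :: "nat \<Rightarrow> (nat \<Rightarrow> nat) \<Rightarrow> (nat \<times> nat) set" where
  "graph n \<pi> = (\<lambda>i. (i, \<pi> i)) ` {1..n}"

lemma card_graph [simp]: "card (graph n \<pi>) = n"
  by (simp add: graph_def card_image inj_on_def)

text \<open>With \<open>n\<close> rooks no row or column stays open, so the placement is the graph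
  of a bijection.\<close>

lemma bij_betw_graph:
  "bij_betw (graph n) {\<pi>. \<pi> permutes {1..n}} {P\<in>placements n n. card P = n}"
proof (rule bij_betw_imageI)
  show "inj_on (graph n) {\<pi>. \<pi> permutes {1..n}}"
  proof (rule inj_onI, rule ext)
    fix \<pi> \<sigma> i
    assume perms: "\<pi> \<in> {\<pi>. \<pi> permutes {1..n}}" "\<sigma> \<in> {\<pi>. \<pi> permutes {1..n}}"
      and eq: "graph n \<pi> = graph n \<sigma>"
    show "\<pi> i = \<sigma> i"
    proof (cases "i \<in> {1..n}")
      case True
      then have "(i, \<pi> i) \<in> graph n \<sigma>" unfolding eq[symmetric] by (simp add: graph_def)
      then show ?thesis by (auto simp: graph_def)
    next
      case False
      with perms show ?thesis by (simp add: permutes_not_in del: atLeastAtMost_iff)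
    qed
  qed
  show "graph n ` {\<pi>. \<pi> permutes {1..n}} = {P\<in>placements n n. card P = n}"
  proof (intro equalityI subsetI)
    fix P assume "P \<in> graph n ` {\<pi>. \<pi> permutes {1..n}}"
    then obtain \<pi> where \<pi>: "\<pi> permutes {1..n}" and P: "P = graph n \<pi>" by auto
    have "inj_on snd P"
      using permutes_inj[OF \<pi>] by (auto simp: P graph_def inj_on_def)
    moreover have "inj_on fst P" by (auto simp: P graph_def inj_on_def)
    moreover have "P \<subseteq> {1..n} \<times> {1..n}"
      unfolding P graph_def using permutes_in_image[OF \<pi>] by blast
    ultimately have "P \<in> placements n n" by (simp add: placements_def)
    then show "P \<in> {P\<in>placements n n. card P = n}" by (simp add: P)
  next
    fix P assume "P \<in> {P\<in>placements n n. card P = n}"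
    then have P: "P \<in> placements n n" "card P = n" by auto
    note D = placementsD[OF P(1)]
    have "card (open_rows n P) = 0" "card (open_cols n P) = 0"
      using card_open_rows[OF P(1)] card_open_cols[OF P(1)] P(2) by auto
    then have img: "fst ` P = {1..n}" "snd ` P = {1..n}"
      using D(1) by (auto simp: open_rows_def open_cols_def)
    \<comment> \<open>\<open>inv_into P fst i\<close> is the only rook in row \<open>i\<close>;
      outside the range, \<open>permutes\<close> demands the identity.\<close>
    define \<pi> where "\<pi> = (\<lambda>i. if i \<in> {1..n} then snd (inv_into P fst i) else i)"
    have "bij_betw (inv_into P fst) {1..n} P"
      using D(2) img by (intro bij_betw_inv_into) (simp add: bij_betw_def)
    then have "bij_betw (snd \<circ> inv_into P fst) {1..n} {1..n}"
      by (rule bij_betw_trans) (use D(3) img in \<open>simp add: bij_betw_def\<close>)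
    then have "bij_betw \<pi> {1..n} {1..n}"
      by (rule iffD1[OF bij_betw_cong, rotated]) (simp add: \<pi>_def)
    then have \<pi>: "\<pi> permutes {1..n}"
      by (rule bij_imp_permutes) (auto simp: \<pi>_def)
    have *: "(i, \<pi> i) = inv_into P fst i" if "i \<in> {1..n}" for i
      using f_inv_into_f[of i fst P] that img by (simp add: \<pi>_def prod_eq_iff)
    have "graph n \<pi> = inv_into P fst ` {1..n}"
      unfolding graph_def by (intro image_cong refl *)
    also have "\<dots> = P" using \<open>bij_betw (inv_into P fst) {1..n} P\<close> by (simp add: bij_betw_def)
    finally show "P \<in> graph n ` {\<pi>. \<pi> permutes {1..n}}" using \<pi> by blast
  qed
qed

section \<open>Statistics of a permutation read off its graph\<close>

lemma card_pred_graph: "card {x \<in> graph n \<pi>. Q (fst x) (snd x)} = card {i\<in>{1..n}. Q i (\<pi> i)}"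
proof -
  have "{x \<in> graph n \<pi>. Q (fst x) (snd x)} = (\<lambda>i. (i, \<pi> i)) ` {i\<in>{1..n}. Q i (\<pi> i)}"
    by (auto simp: graph_def)
  then show ?thesis by (simp add: card_image inj_on_def)
qed

text \<open>Among the first \<open>i\<close> rows, those with \<open>\<pi> j \<le> i\<close> have
  their rook in the leading square; the others are the ones counted in
  \<open>bounded_perms\<close>.\<close>

lemma bounded_defect_graph:
  assumes "\<pi> permutes {1..n}"
  shows "bounded_defect k n (graph n \<pi>) \<longleftrightarrow> \<pi> \<in> bounded_perms k n"
proof -
  have "i \<le> card (graph n \<pi> \<inter> {1..i} \<times> {1..i}) + k \<longleftrightarrow> card {j\<in>{1..n}. j \<le> i \<and> \<pi> j > i} \<le> k"
    if i: "i \<le> n" for i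
  proof -
    have pos: "1 \<le> \<pi> j" if "j \<in> {1..n}" for j
      using permutes_in_image[OF assms, of j] that by auto
    have "graph n \<pi> \<inter> {1..i} \<times> {1..i} = {x \<in> graph n \<pi>. fst x \<le> i \<and> snd x \<le> i}"
      using pos by (auto simp: graph_def)
    then have "card (graph n \<pi> \<inter> {1..i} \<times> {1..i}) = card {j\<in>{1..n}. j \<le> i \<and> \<pi> j \<le> i}"
      by (simp add: card_pred_graph[where Q = "\<lambda>a b. a \<le> i \<and> b \<le> i"])
    moreover have "{1..i} = {j\<in>{1..n}. j \<le> i \<and> \<pi> j \<le> i} \<union> {j\<in>{1..n}. j \<le> i \<and> \<pi> j > i}"
      using i by auto
    then have "card {1..i} = card {j\<in>{1..n}. j \<le> i \<and> \<pi> j \<le> i} + card {j\<in>{1..n}. j \<le> i \<and> \<pi> j > i}"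
      by (simp only:) (rule card_Un_disjoint, auto)
    ultimately show ?thesis by auto
  qed
  \<comment> \<open>The two conditions range over different indices; at \<open>i = 0\<close> the set
    is empty.\<close>
  moreover have "(\<forall>i\<le>n. card {j\<in>{1..n}. j \<le> i \<and> \<pi> j > i} \<le> k)
      \<longleftrightarrow> (\<forall>i\<in>{1..n}. card {j\<in>{1..n}. j \<le> i \<and> \<pi> j > i} \<le> k)" (is "?L \<longleftrightarrow> ?R")
  proof
    assume R: ?R
    show ?L
    proof (intro allI impI)
      fix i assume "i \<le> n"
      show "card {j\<in>{1..n}. j \<le> i \<and> \<pi> j > i} \<le> k"
      proof (cases "i = 0")
        case True
        then have "{j\<in>{1..n}. j \<le> i \<and> \<pi> j > i} = {}" by auto
        then show ?thesis by (simp only: card.empty le0)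
      next
        case False
        then have "i \<in> {1..n}" using \<open>i \<le> n\<close> by simp
        with R show ?thesis by blast
      qed
    qed
  next
    assume L: ?L
    show ?R
    proof
      fix i assume "i \<in> {1..n}"
      then have "i \<le> n" by simp
      with L show "card {j\<in>{1..n}. j \<le> i \<and> \<pi> j > i} \<le> k" by blast
    qed
  qed
  ultimately show ?thesis
    using assms by (simp add: bounded_defect_def bounded_perms_def)
qed

lemma sum_pred_eq_choose: "(\<Sum>i = 1..n. int i - 1) = int (n choose 2)"
  by (induction n) (simp_all add: numeral_2_eq_2)

lemma card_less_pairs: "card {(i, j). i \<in> {1..n} \<and> j \<in> {1..n} \<and> i < j} = n choose 2" for n :: nat
proof -
  have "{(i, j). i \<in> {1..n} \<and> j \<in> {1..n} \<and> i < j} = prod.swap ` (SIGMA j:{1..n}. {1..<j})"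
    by (auto simp: image_def)
  then have "card {(i, j). i \<in> {1..n} \<and> j \<in> {1..n} \<and> i < j} = (\<Sum>j = 1..n. j - 1)"
    by (simp add: card_image)
  moreover have "int (\<Sum>j = 1..n. j - 1) = (\<Sum>j = 1..n. int j - 1)"
    by (simp add: of_nat_diff)
  ultimately show ?thesis using sum_pred_eq_choose[of n] by linarith
qed

text \<open>Both coordinate sums equal \<open>n choose 2\<close>. One cancels the last term of
  \<open>forced_inv\<close>; the other, less the non-inversions, leaves the inversions.\<close>

lemma forced_inv_graph:
  assumes \<pi>: "\<pi> permutes {1..n}"
  shows "forced_inv (graph n \<pi>) = int (inv_stat n \<pi>)"
proof -
  let ?I = "{(i, j). i \<in> {1..n} \<and> j \<in> {1..n} \<and> i < j \<and> \<pi> i > \<pi> j}"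
  let ?N = "{(i, j). i \<in> {1..n} \<and> j \<in> {1..n} \<and> i < j \<and> \<pi> i < \<pi> j}"
  have inj: "inj_on (\<lambda>i. (i, \<pi> i)) {1..n}" by (simp add: inj_on_def)
  have fin: "finite ?I" "finite ?N"
    by (rule finite_subset[of _ "{1..n} \<times> {1..n}"]; force)+
  have "\<pi> i \<noteq> \<pi> j" if "i < j" for i j
    using injD[OF permutes_inj[OF \<pi>], of i j] that by auto
  then have "{(i, j). i \<in> {1..n} \<and> j \<in> {1..n} \<and> i < j} = ?I \<union> ?N"
    by (auto simp: neq_iff)
  then have "n choose 2 = card (?I \<union> ?N)" by (metis card_less_pairs)
  also have "\<dots> = card ?I + card ?N"
    by (rule card_Un_disjoint[OF fin]) auto
  finally have split: "n choose 2 = inv_stat n \<pi> + card ?N" by (simp add: inv_stat_def)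
  have "{(x, y). x \<in> graph n \<pi> \<and> y \<in> graph n \<pi> \<and> fst x < fst y \<and> snd x < snd y}
      = (\<lambda>(i, j). ((i, \<pi> i), (j, \<pi> j))) ` ?N"
    by (auto simp: graph_def image_iff)
  then have nw: "nw_pairs (graph n \<pi>) = card ?N"
    unfolding nw_pairs_def by (simp add: card_image inj_on_def)
  have "(\<Sum>(r, c)\<in>graph n \<pi>. int r - 1 + (int c - 1)) = (\<Sum>i = 1..n. int i - 1) + (\<Sum>i = 1..n. int (\<pi> i) - 1)"
    unfolding graph_def by (subst sum.reindex[OF inj]) (simp add: o_def flip: sum.distrib)
  also have "(\<Sum>i = 1..n. int (\<pi> i) - 1) = (\<Sum>i = 1..n. int i - 1)"
    using sum.permute[OF \<pi>, of "\<lambda>i. int i - 1"] by (simp add: o_def)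
  finally show ?thesis
    unfolding forced_inv_def using split nw sum_pred_eq_choose[of n] by simp
qed

lemma weight_graph:
  assumes "\<pi> permutes {1..n}"
  shows "weight (graph n \<pi>) = var_q ^ inv_stat n \<pi> * var_u ^ fp_stat n \<pi> * var_v ^ exc_stat n \<pi>"
proof -
  have "fp_stat n \<pi> = card {i\<in>{1..n}. i = \<pi> i}"
    unfolding fp_stat_def by (rule arg_cong[of _ _ card]) auto
  then show ?thesis
    unfolding weight_def forced_inv_graph[OF assms] exc_stat_def nat_int
      card_pred_graph[of n \<pi> "\<lambda>a b. a = b"] card_pred_graph[of n \<pi> "\<lambda>a b. a < b"]
    by (simp only:)
qed

lemma path_wt_perms:
  "path_wt k n 0 = (\<Sum>\<pi>\<in>bounded_perms k n. var_q ^ inv_stat n \<pi> * var_u ^ fp_stat n \<pi> * var_v ^ exc_stat n \<pi>)"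
proof -
  \<comment> \<open>Needed because the truncated \<open>n - card P = 0\<close> only says
    \<open>n \<le> card P\<close>.\<close>
  have le: "card P \<le> n" if "P \<in> placements n n" for P using card_open_rows[OF that] by simp
  have "path_wt k n 0 = (\<Sum>P\<in>placements n n. if card P = n then (if bounded_defect k n P then weight P else 0) else 0)"
    unfolding path_wt_def height_sum_def by (intro sum.cong) (auto dest: le)
  also have "\<dots> = (\<Sum>P\<in>{P\<in>placements n n. card P = n}. if bounded_defect k n P then weight P else 0)"
    by (simp add: sum.inter_filter)
  also have "\<dots> = (\<Sum>\<pi>\<in>{\<pi>. \<pi> permutes {1..n}}. if bounded_defect k n (graph n \<pi>) then weight (graph n \<pi>) else 0)"
    by (rule sum.reindex_bij_betw[OF bij_betw_graph, symmetric])
  also have "\<dots> = (\<Sum>\<pi>\<in>{\<pi>. \<pi> permutes {1..n}}. if \<pi> \<in> bounded_perms k n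
      then var_q ^ inv_stat n \<pi> * var_u ^ fp_stat n \<pi> * var_v ^ exc_stat n \<pi> else 0)"
    by (intro sum.cong) (auto simp: bounded_defect_graph weight_graph)
  also have "\<dots> = (\<Sum>\<pi>\<in>{\<pi>\<in>{\<pi>. \<pi> permutes {1..n}}. \<pi> \<in> bounded_perms k n}.
      var_q ^ inv_stat n \<pi> * var_u ^ fp_stat n \<pi> * var_v ^ exc_stat n \<pi>)"
    by (rule sum.inter_filter[symmetric]) (simp add: finite_permutations)
  also have "{\<pi>\<in>{\<pi>. \<pi> permutes {1..n}}. \<pi> \<in> bounded_perms k n} = bounded_perms k n"
    by (auto simp: bounded_perms_def)
  finally show ?thesis .
qed

text \<open>Each permutation contributes a single monomial, so comparing coefficients replaces a
  regrouping of the sum by the values of the statistics.\<close>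

lemma G_series_nth:
  "fps_nth (G_series k) n = (\<Sum>\<pi>\<in>bounded_perms k n. var_q ^ inv_stat n \<pi> * var_u ^ fp_stat n \<pi> * var_v ^ exc_stat n \<pi>)"
proof (intro poly_eqI)
  fix j i r
  have "coeff (coeff (coeff (\<Sum>\<pi>\<in>bounded_perms k n. var_q ^ inv_stat n \<pi> * var_u ^ fp_stat n \<pi> * var_v ^ exc_stat n \<pi>) j) i) r
    = (\<Sum>\<pi>\<in>bounded_perms k n. if inv_stat n \<pi> = r \<and> fp_stat n \<pi> = i \<and> exc_stat n \<pi> = j then 1 else 0)"
    unfolding coeff_sum
  proof (intro sum.cong refl)
    fix \<pi>
    show "coeff (coeff (coeff (var_q ^ inv_stat n \<pi> * var_u ^ fp_stat n \<pi> * var_v ^ exc_stat n \<pi>) j) i) r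
      = (if inv_stat n \<pi> = r \<and> fp_stat n \<pi> = i \<and> exc_stat n \<pi> = j then 1 else 0)"
      using monomial_eq[of 1 "inv_stat n \<pi>" "fp_stat n \<pi>" "exc_stat n \<pi>"] by simp
  qed
  also have "\<dots> = int (card {\<pi> \<in> bounded_perms k n. inv_stat n \<pi> = r \<and> fp_stat n \<pi> = i \<and> exc_stat n \<pi> = j})"
    by (simp add: finite_bounded_perms flip: sum.inter_filter)
  finally show "coeff (coeff (coeff (fps_nth (G_series k) n) j) i) r = coeff (coeff (coeff
      (\<Sum>\<pi>\<in>bounded_perms k n. var_q ^ inv_stat n \<pi> * var_u ^ fp_stat n \<pi> * var_v ^ exc_stat n \<pi>) j) i) r"
    by (simp add: coeff_G_series)
qed

theorem theorem6p2:
  fixes k :: nat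
  shows "G_series k = fps_recip (cf_denom k 0)"
proof -
  have "G_series k = path_series k 0"
    by (simp add: fps_eq_iff G_series_nth path_series_def path_wt_perms)
  also have "\<dots> = fps_recip (cf_denom k 0) * (cf_denom k 0 * path_series k 0)"
    using fps_recip(2)[OF cf_denom_nth_0[of k 0]] by (simp flip: mult.assoc)
  also have "\<dots> = fps_recip (cf_denom k 0)"
    by (simp add: cf_denom_path_series)
  finally show ?thesis .
qed

end
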